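(* Let $\{P_1,\ldots,P_{22}\}\subseteq\mathbb{F}_8^2$ be the set of the 22 affine $\mathbb{F}_8$-rational zeros of the Klein quartic $Y^3+X^3Y+X$. With the monomials $M_1,\ldots,M_{22}$ of the context and with $F_1^\perp=X^7+1$, $F_2^\perp=X^6$, $F_3^\perp=X^6Y^2$, $F_4^\perp=X^5$, $F_5^\perp=X^5Y^2$, $F_6^\perp=X^4$, $F_7^\perp=X^6Y$, $F_8^\perp=X^4Y^2$, $F_9^\perp=X^3$, $F_{10}^\perp=X^5Y$, $F_{11}^\perp=X^3Y^2$, $F_{12}^\perp=X^2$, $F_{13}^\perp=X^4Y$, $F_{14}^\perp=X^2Y^2$, $F_{15}^\perp=X$, $F_{16}^\perp=X^3Y$, $F_{17}^\perp=XY^2$, $F_{18}^\perp=1$, $F_{19}^\perp=X^2Y$, $F_{20}^\perp=Y^2$, $F_{21}^\perp=XY$, $F_{22}^\perp=Y$, it holds for all $i,j\in\{1,\ldots,22\}$ that $$\sum_{s=1}^{22}M_i(P_s)F_j^\perp(P_s)=\delta_{i,j},$$ where $\delta_{i,j}$ is the Kronecker delta. In particular, for every $A\subseteq\{1,\ldots,22\}$ the dual code of $\mathrm{Span}_{\mathbb{F}_8}\{\mathrm{ev}(M_i)\mid i\in A\}$ equals $\mathrm{Span}_{\mathbb{F}_8}\{\mathrm{ev}(F_j^\perp)\mid j\notin A\}$.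
   Context: For a polynomial $F\in\mathbb{F}_8[X,Y]$, $\mathrm{ev}(F)=(F(P_1),\ldots,F(P_{22}))\in\mathbb{F}_8^{22}$. Duals are taken with respect to the standard bilinear form. The monomials are, in order, $M_1=1$, $M_2=X$, $M_3=Y$, $M_4=X^2$, $M_5=XY$, $M_6=X^3$, $M_7=Y^2$, $M_8=X^2Y$, $M_9=X^4$, $M_{10}=XY^2$, $M_{11}=X^3Y$, $M_{12}=X^5$, $M_{13}=X^2Y^2$, $M_{14}=X^4Y$, $M_{15}=X^6$, $M_{16}=X^3Y^2$, $M_{17}=X^5Y$, $M_{18}=X^7$, $M_{19}=X^4Y^2$, $M_{20}=X^6Y$, $M_{21}=X^5Y^2$, $M_{22}=X^6Y^2$. *)

theory Defs
  imports "HOL-Analysis.Analysis" "HOL-Computational_Algebra.Polynomial"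
begin

(* A bivariate polynomial over 'a is an element of 'a poly poly = 'a[X][Y]:
   the inner indeterminate is X, the outer one is Y. *)

definition varX :: "'a::comm_ring_1 poly poly" where
  "varX = [:[:0, 1:]:]"

definition varY :: "'a::comm_ring_1 poly poly" where
  "varY = [:0, 1:]"

(* F(x, y): substitute the constant polynomial y for Y, then x for X. *)
definition eval2 :: "'a::comm_ring_1 poly poly \<Rightarrow> 'a \<times> 'a \<Rightarrow> 'a" where
  "eval2 F p = poly (poly F [:snd p:]) (fst p)"

lemma eval2_simps [simp]:
  "eval2 0 p = 0" "eval2 1 p = 1"
  "eval2 varX p = fst p" "eval2 varY p = snd p"
  "eval2 (F + G) p = eval2 F p + eval2 G p"
  "eval2 (F * G) p = eval2 F p * eval2 G p"
  "eval2 (F ^ n) p = eval2 F p ^ n"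
  by (simp_all add: eval2_def varX_def varY_def)

definition klein_quartic :: "'a::comm_ring_1 poly poly" where
  "klein_quartic = varY ^ 3 + varX ^ 3 * varY + varX"

definition klein_points :: "('a::comm_ring_1 \<times> 'a) set" where
  "klein_points = {p. eval2 klein_quartic p = 0}"

(* The type 22 only labels the coordinates; P enumerates the evaluation points. *)
definition ev :: "(22 \<Rightarrow> 'a \<times> 'a) \<Rightarrow> 'a::comm_ring_1 poly poly \<Rightarrow> 'a ^ 22" where
  "ev P F = (\<chi> s. eval2 F (P s))"

definition dual_code :: "('a::comm_ring_1 ^ 'n) set \<Rightarrow> ('a ^ 'n) set" where
  "dual_code C = {w. \<forall>c\<in>C. scalar_product c w = 0}"

(* The families M and Fperp are indexed from 1 to 22; values outside are irrelevant. *)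
definition M :: "nat \<Rightarrow> 'a::comm_ring_1 poly poly" where
  "M i =
    [1,
     varX,
     varY,
     varX ^ 2,
     varX * varY,
     varX ^ 3,
     varY ^ 2,
     varX ^ 2 * varY,
     varX ^ 4,
     varX * varY ^ 2,
     varX ^ 3 * varY,
     varX ^ 5,
     varX ^ 2 * varY ^ 2,
     varX ^ 4 * varY,
     varX ^ 6,
     varX ^ 3 * varY ^ 2,
     varX ^ 5 * varY,
     varX ^ 7,
     varX ^ 4 * varY ^ 2,
     varX ^ 6 * varY,
     varX ^ 5 * varY ^ 2,
     varX ^ 6 * varY ^ 2] ! (i - 1)"

definition Fperp :: "nat \<Rightarrow> 'a::comm_ring_1 poly poly" where
  "Fperp j =
    [varX ^ 7 + 1,
     varX ^ 6,
     varX ^ 6 * varY ^ 2,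
     varX ^ 5,
     varX ^ 5 * varY ^ 2,
     varX ^ 4,
     varX ^ 6 * varY,
     varX ^ 4 * varY ^ 2,
     varX ^ 3,
     varX ^ 5 * varY,
     varX ^ 3 * varY ^ 2,
     varX ^ 2,
     varX ^ 4 * varY,
     varX ^ 2 * varY ^ 2,
     varX,
     varX ^ 3 * varY,
     varX * varY ^ 2,
     1,
     varX ^ 2 * varY,
     varY ^ 2,
     varX * varY,
     varY] ! (j - 1)"

end

theory Submission
  imports Defs
begin

text \<open>
  A zero of the quartic with \<open>x \<noteq> 0\<close> has the form \<open>(x, x\<^sup>5 t)\<close> where \<open>t\<close> is one of the three
  roots of \<open>t\<^sup>3 + t + 1\<close>.  Hence the sum of \<open>X\<^sup>a Y\<^sup>b\<close> over these 21 points is the product of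
  the sum of \<open>x\<close> to the power \<open>a + 5 b\<close> over the nonzero \<open>x\<close>, which detects \<open>7 dvd a + 5 b\<close>, and
  of the \<open>b\<close>-th power sum of the roots, which for \<open>b \<le> 4\<close> vanishes unless \<open>b = 0\<close> or \<open>b = 3\<close>.
  So the sum over the curve only depends on the exponents, and biorthogonality becomes a finite check.
  Biorthogonal families of full length consist of dual bases, which gives the dual codes.
\<close>

section \<open>Biorthogonal families\<close>

lemma scalar_product_sum_scale:
  fixes f :: "'b \<Rightarrow> 'a::comm_ring_1 ^ 'n"
  shows "scalar_product v (\<Sum>j\<in>J. c j *s f j) = (\<Sum>j\<in>J. c j * scalar_product v (f j))"
  unfolding scalar_product_def
  by (simp add: sum_distrib_left mult_ac sum.swap[of _ J])

text \<open>Pairing with \<open>m i\<close> reads off the coefficient of \<open>f i\<close> in any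
  combination, so the \<open>f j\<close> are independent. Having as many as the dimension, they
  span, and the coefficients of \<open>w\<close> are read off the same way.\<close>

lemma biorthogonal_expansion:
  fixes m f :: "'b \<Rightarrow> 'a::field ^ 'n"
  assumes fin: "finite I" and card: "card I = CARD('n)"
    and bi: "\<And>i j. i \<in> I \<Longrightarrow> j \<in> I \<Longrightarrow> scalar_product (m i) (f j) = (if i = j then 1 else 0)"
  shows "w = (\<Sum>j\<in>I. scalar_product (m j) w *s f j)"
proof -
  have coeff: "scalar_product (m i) (\<Sum>j\<in>I. c j *s f j) = c i" if "i \<in> I" for c i
  proof -
    have "scalar_product (m i) (\<Sum>j\<in>I. c j *s f j) = (\<Sum>j\<in>I. if j = i then c j else 0)"
      unfolding scalar_product_sum_scale by (rule sum.cong) (use that in \<open>auto simp: bi\<close>)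
    then show ?thesis using fin that by simp
  qed
  \<comment> \<open>If \<open>f i = f j\<close> with \<open>i \<noteq> j\<close>, pairing both with
    \<open>m i\<close> gives 1 = 0.\<close>
  have inj: "inj_on f I"
    using bi by (metis inj_onI zero_neq_one)
  have ind: "vec.independent (f ` I)"
  proof (rule vec.independent_if_scalars_zero)
    fix c x assume "(\<Sum>x\<in>f ` I. c x *s x) = 0" "x \<in> f ` I"
    then obtain i where i: "i \<in> I" "x = f i" "(\<Sum>j\<in>I. c (f j) *s f j) = 0"
      by (auto simp: sum.reindex[OF inj])
    then show "c x = 0"
      using coeff[of i "\<lambda>j. c (f j)"] by (simp add: scalar_product_def)
  qed (use fin in simp)
  have "UNIV \<subseteq> vec.span (f ` I)"
    by (rule vec.card_ge_dim_independent) (use ind card inj in \<open>auto simp: card_image vec_dim_card simp del: vec.dim_UNIV\<close>)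
  then have "w \<in> vec.span (f ` I)" by blast
  then obtain u where "w = (\<Sum>v\<in>f ` I. u v *s v)"
    using fin by (auto simp: vec.span_finite)
  then have w: "w = (\<Sum>j\<in>I. u (f j) *s f j)" by (simp add: sum.reindex[OF inj])
  then have "scalar_product (m i) w = u (f i)" if "i \<in> I" for i
    using coeff[OF that, of "\<lambda>j. u (f j)"] by simp
  then have "(\<Sum>j\<in>I. scalar_product (m j) w *s f j) = (\<Sum>j\<in>I. u (f j) *s f j)"
    by (intro sum.cong) simp_all
  then show ?thesis using w by simp
qed

lemma dual_code_span:
  fixes C :: "('a::field ^ 'n) set"
  shows "dual_code (vec.span C) = dual_code C"
proof
  show "dual_code (vec.span C) \<subseteq> dual_code C"
    by (auto simp: dual_code_def vec.span_base)
  show "dual_code C \<subseteq> dual_code (vec.span C)"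
  proof
    fix w assume w: "w \<in> dual_code C"
    have "scalar_product c w = 0" if "c \<in> vec.span C" for c
      using that
    proof (induction rule: vec.span_induct_alt)
      case base then show ?case by (simp add: scalar_product_def)
    next
      case (step a x y)
      have "scalar_product (a *s x + y) w = a * scalar_product x w + scalar_product y w"
        by (simp add: scalar_product_def algebra_simps sum.distrib sum_distrib_left)
      with step w show ?case by (simp add: dual_code_def)
    qed
    then show "w \<in> dual_code (vec.span C)" by (simp add: dual_code_def)
  qed
qed

text \<open>Membership in the dual says that the coefficients of \<open>w\<close> at indices in
  \<open>A\<close> vanish in the expansion along \<open>f\<close>. Conversely, each
  \<open>f j\<close> with \<open>j\<close> outside \<open>A\<close> is orthogonal to all generators,
  and the dual is a subspace.\<close>

lemma dual_code_biorthogonal: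
  fixes m f :: "'b \<Rightarrow> 'a::field ^ 'n"
  assumes "finite I" "card I = CARD('n)" "A \<subseteq> I"
    and bi: "\<And>i j. i \<in> I \<Longrightarrow> j \<in> I \<Longrightarrow> scalar_product (m i) (f j) = (if i = j then 1 else 0)"
  shows "dual_code (vec.span (m ` A)) = vec.span (f ` (I - A))"
  unfolding dual_code_span
proof
  show "dual_code (m ` A) \<subseteq> vec.span (f ` (I - A))"
  proof
    fix w assume w: "w \<in> dual_code (m ` A)"
    have "w = (\<Sum>j\<in>I. scalar_product (m j) w *s f j)"
      using assms by (intro biorthogonal_expansion) auto
    also have "\<dots> = (\<Sum>j\<in>I - A. scalar_product (m j) w *s f j)"
      by (rule sum.mono_neutral_right) (use w assms in \<open>auto simp: dual_code_def\<close>)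
    also have "\<dots> \<in> vec.span (f ` (I - A))"
      by (intro vec.span_sum vec.span_scale vec.span_base) auto
    finally show "w \<in> vec.span (f ` (I - A))" .
  qed
  have "vec.subspace (dual_code (m ` A))"
    by (auto simp: vec.subspace_def dual_code_def scalar_product_def algebra_simps sum.distrib
        simp flip: sum_distrib_left)
  moreover have "f ` (I - A) \<subseteq> dual_code (m ` A)"
    using \<open>A \<subseteq> I\<close> bi by (auto simp: dual_code_def)
  ultimately show "vec.span (f ` (I - A)) \<subseteq> dual_code (m ` A)"
    by (rule vec.span_minimal[rotated])
qed

section \<open>The field with eight elements\<close>

text \<open>Translation by 1 permutes the field, so the sum of all elements is unchanged by adding 8
  = 2^3.\<close>

lemma two_eq_0_card8:
  assumes "CARD('a::{field, finite}) = 8"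
  shows "(2::'a) = 0"
proof -
  have "(\<Sum>x\<in>(UNIV::'a set). x) = (\<Sum>x\<in>UNIV. x + 1)"
    by (rule sum.reindex_bij_witness[of _ "\<lambda>x. x + 1" "\<lambda>x. x - 1"]) auto
  then have "(2::'a) ^ 3 = 0"
    using assms by (simp add: sum.distrib)
  then show ?thesis by (rule power_eq_0_iff[THEN iffD1, THEN conjunct1])
qed

text \<open>Multiplication by \<open>x\<close> permutes the seven nonzero elements; their product
  cancels.\<close>

lemma power7_card8:
  fixes x :: "'a::{field, finite}"
  assumes "CARD('a) = 8" "x \<noteq> 0"
  shows "x ^ 7 = 1"
proof -
  have "(\<Prod>y\<in>UNIV - {0}. y) = (\<Prod>y\<in>UNIV - {0}. x * y)"
    by (rule prod.reindex_bij_witness[of _ "\<lambda>y. x * y" "\<lambda>y. y / x"]) (use assms in auto)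
  also have "\<dots> = x ^ 7 * (\<Prod>y\<in>UNIV - {0}. y)"
    using assms by (simp add: prod.distrib card_Diff_singleton)
  finally show ?thesis by simp
qed

text \<open>Modulo 2, \<open>X^7 - 1\<close> is \<open>X - 1\<close> times two cubics, so any
  \<open>u\<close> other than 0 and 1 is a root of one of them. The cubics are reciprocal to each
  other, so \<open>u\<close> or its inverse serves.\<close>

lemma klein_root_exists:
  assumes "CARD('a::{field, finite}) = 8"
  shows "\<exists>t::'a. t ^ 3 = t + 1"
proof -
  note two = two_eq_0_card8[OF assms]
  have "\<not> (UNIV::'a set) \<subseteq> {0, 1}"
    using card_mono[of "{0, 1::'a}" UNIV] assms by auto
  then obtain u :: 'a where u: "u \<noteq> 0" "u \<noteq> 1" by auto
  have u7: "u ^ 7 = 1" using power7_card8[OF assms u(1)] .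
  \<comment> \<open>The identity is stated with its error as an explicit multiple of 2, which
    characteristic 2 then removes. Later identities use the same device.\<close>
  have "(u - 1) * ((u ^ 3 - u - 1) * (u ^ 3 + u ^ 2 + 1)) = 2 * (1 - u ^ 5)"
    using u7 by algebra
  then have "(u - 1) * ((u ^ 3 - u - 1) * (u ^ 3 + u ^ 2 + 1)) = 0" using two by simp
  then consider "u ^ 3 - u - 1 = 0" | "u ^ 3 + u ^ 2 + 1 = 0" using u by auto
  then show ?thesis
  proof cases
    case 1
    then have "u ^ 3 = u + 1" by algebra
    then show ?thesis ..
  next
    case 2
    have "(inverse u) ^ 3 = inverse u + 1"
    proof -
      have "u * inverse u = 1" using u by simp
      then have "(inverse u) ^ 3 = inverse u + 1 - 2 * (inverse u + 1)" using 2 by algebra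
      then show ?thesis using two by simp
    qed
    then show ?thesis ..
  qed
qed

section \<open>Power sums over the field, the cubic and the quartic\<close>

context
  fixes t :: "'a::{field, finite}"
  assumes card8: "CARD('a) = 8" and root: "t ^ 3 = t + 1"
begin

lemma root_nonzero: "t \<noteq> 0"
  using root by auto

lemma root_neq_1: "t \<noteq> 1"
  using root two_eq_0_card8[OF card8] by auto

text \<open>If 7 divides \<open>k\<close>, the seven terms are all 1, and 7 is odd. Otherwise the
  substitution of \<open>t * x\<close> for \<open>x\<close> scales the sum by \<open>t ^ k\<close>,
  which is not 1.\<close>

lemma power_sum_nonzero:
  "(\<Sum>x\<in>UNIV - {0::'a}. x ^ k) = (if 7 dvd k then 1 else 0)"
proof (cases "7 dvd k")
  case True
  then obtain q where "k = 7 * q" ..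
  then have "(\<Sum>x\<in>UNIV - {0::'a}. x ^ k) = (\<Sum>x\<in>UNIV - {0::'a}. 1)"
    by (intro sum.cong) (auto simp: power_mult power7_card8[OF card8])
  also have "\<dots> = 2 * 3 + 1" using card8 by (simp add: card_Diff_singleton)
  finally show ?thesis using True two_eq_0_card8[OF card8] by simp
next
  case False
  let ?S = "\<Sum>x\<in>UNIV - {0::'a}. x ^ k"
  have "?S = (\<Sum>x\<in>UNIV - {0::'a}. (t * x) ^ k)"
    by (rule sum.reindex_bij_witness[of _ "\<lambda>x. t * x" "\<lambda>x. x / t"]) (use root_nonzero in auto)
  also have "\<dots> = t ^ k * ?S" by (simp add: power_mult_distrib sum_distrib_left)
  finally have "(t ^ k - 1) * ?S = 0" by (simp add: algebra_simps)
  moreover have "t ^ k \<noteq> 1"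
  proof
    assume *: "t ^ k = 1"
    \<comment> \<open>By Bezout, \<open>t ^ k = 1\<close> together with \<open>t ^ 7 = 1\<close>
      would give \<open>t = 1\<close>.\<close>
    have "coprime k 7"
      using False prime_imp_coprime[of 7 k] by (simp add: coprime_commute)
    then obtain r s where "k * r = 7 * s + 1"
      using bezout_nat[of k 7] False by (cases "k = 0") auto
    then have "t ^ (k * r) = t ^ (7 * s + 1)" by simp
    then show False
      using * root_neq_1 power7_card8[OF card8 root_nonzero] by (simp add: power_mult power_add)
  qed
  ultimately show ?thesis using False by simp
qed

text \<open>The roots are the orbit of \<open>t\<close> under the Frobenius map; expanding the
  product of their linear factors recovers the cubic up to a multiple of 2.\<close>

lemma cubic_roots: "s ^ 3 + s + 1 = 0 \<longleftrightarrow> s \<in> {t, t ^ 2, t ^ 4}"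
proof -
  have "s ^ 3 + s + 1 = (s - t) * ((s - t ^ 2) * (s - t ^ 4)) +
      2 * ((t ^ 2 + t) * s ^ 2 - (t ^ 2 + 2 * t + 1) * s + (t ^ 2 + t + 1))"
    using root by algebra
  then have "s ^ 3 + s + 1 = (s - t) * ((s - t ^ 2) * (s - t ^ 4))"
    using two_eq_0_card8[OF card8] by simp
  then show ?thesis by auto
qed

lemma cubic_roots_distinct: "t \<noteq> t ^ 2" "t \<noteq> t ^ 4" "t ^ 2 \<noteq> t ^ 4"
proof -
  have "t * (t - 1) \<noteq> 0" using root_nonzero root_neq_1 by simp
  then show "t \<noteq> t ^ 2" by (auto simp: power2_eq_square algebra_simps)
  have t4: "t ^ 4 = t ^ 2 + t" using root by algebra
  show "t \<noteq> t ^ 4" "t ^ 2 \<noteq> t ^ 4" unfolding t4 using root_nonzero by auto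
qed

lemma power_sum_roots:
  assumes "b \<le> 4"
  shows "(\<Sum>s\<in>{t, t ^ 2, t ^ 4}. s ^ b) = (if b = 0 \<or> b = 3 then 1 else 0)"
proof -
  have "b \<in> {0, 1, 2, 3, 4}" using assms by auto
  \<comment> \<open>For \<open>b\<close> = 1, 2, 4 the terms are the three roots in rotated order,
    hence one identity per ordering. High powers are reduced by \<open>t ^ 7 = 1\<close>.\<close>
  moreover have "t + (t ^ 2 + t ^ 4) = 2 * (t ^ 2 + t)" using root by algebra
  moreover have "t ^ 2 + (t ^ 4 + t) = 2 * (t ^ 2 + t)" using root by algebra
  moreover have "t ^ 4 + (t + t ^ 2) = 2 * (t ^ 2 + t)" using root by algebra
  moreover have "t ^ 3 + (t ^ 6 + t ^ 5) = 1 + 2 * (t ^ 2 + 2 * t + 1)" using root by algebra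
  moreover have "1 + (1 + 1) = 1 + 2 * (1::'a)" by simp
  moreover have t8: "t ^ 8 = t" and "t ^ 12 = t ^ 5"
    using power_add[of t 7 1] power_add[of t 7 5] power7_card8[OF card8 root_nonzero] by simp_all
  moreover have "t ^ 16 = t ^ 2" using power_mult[of t 8 2] t8 by simp
  ultimately show ?thesis
    using cubic_roots_distinct two_eq_0_card8[OF card8] by (auto simp flip: power_mult)
qed

text \<open>At \<open>x = 0\<close> the equation forces \<open>y = 0\<close>. For other
  \<open>x\<close>, multiplying by \<open>x ^ 6\<close> and using \<open>x ^ 7 = 1\<close> turns it
  into the cubic in \<open>s = x ^ 2 * y\<close>, which inverts to
  \<open>y = x ^ 5 * s\<close>.\<close>

lemma klein_points_eq:
  "klein_points = insert (0, 0) ((\<lambda>(x, s). (x, x ^ 5 * s)) ` ((UNIV - {0}) \<times> {t, t ^ 2, t ^ 4}))"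
  (is "_ = insert _ (?g ` ?D)")
proof -
  have "(x, y) \<in> klein_points \<longleftrightarrow> (x, y) \<in> insert (0, 0) (?g ` ?D)" for x y :: 'a
  proof (cases "x = 0")
    case True
    then show ?thesis by (auto simp: klein_points_def klein_quartic_def)
  next
    case False
    note x7 = power7_card8[OF card8 False]
    have "(x, y) \<in> klein_points \<longleftrightarrow> x ^ 6 * (y ^ 3 + x ^ 3 * y + x) = 0"
      using False by (simp add: klein_points_def klein_quartic_def)
    also have "x ^ 6 * (y ^ 3 + x ^ 3 * y + x) = (x ^ 2 * y) ^ 3 + x ^ 2 * y + 1"
      using x7 by algebra
    also have "\<dots> = 0 \<longleftrightarrow> x ^ 2 * y \<in> {t, t ^ 2, t ^ 4}" by (rule cubic_roots)
    also have "\<dots> \<longleftrightarrow> (\<exists>s\<in>{t, t ^ 2, t ^ 4}. y = x ^ 5 * s)"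
    proof -
      have "x ^ 2 * y = s \<longleftrightarrow> y = x ^ 5 * s" for s using x7 by algebra
      then show ?thesis by auto
    qed
    also have "\<dots> \<longleftrightarrow> (x, y) \<in> insert (0, 0) (?g ` ?D)" using False by auto
    finally show ?thesis .
  qed
  then show ?thesis by (intro set_eqI) (simp only: split_paired_all)
qed

lemma klein_points_param_inj: "inj_on (\<lambda>(x, s). (x, x ^ 5 * s)) ((UNIV - {0}) \<times> (T :: 'a set))"
  by (auto simp: inj_on_def)

lemma card_klein_points: "card (klein_points :: ('a \<times> 'a) set) = 22"
proof -
  have "card ((UNIV - {0::'a}) \<times> {t, t ^ 2, t ^ 4}) = 21"
    using card8 cubic_roots_distinct by (simp add: card_cartesian_product card_Diff_singleton)
  then show ?thesis
    unfolding klein_points_eq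
    by (subst card_insert_disjoint) (auto simp: card_image[OF klein_points_param_inj])
qed

lemma klein_power_sum:
  assumes "b \<le> 4"
  shows "(\<Sum>p\<in>(klein_points :: ('a \<times> 'a) set). fst p ^ a * snd p ^ b) =
    (if b = 0 \<and> 7 dvd a \<and> a \<noteq> 0 \<or> b = 3 \<and> 7 dvd a + 1 then 1 else 0)"
proof -
  let ?T = "{t, t ^ 2, t ^ 4}" and ?g = "\<lambda>(x, s). (x, x ^ 5 * s) :: 'a \<times> 'a"
  have two: "1 + 1 = (0::'a)" using two_eq_0_card8[OF card8] by simp
  have dvd3: "7 dvd a + 15 \<longleftrightarrow> 7 dvd a + 1"
    by presburger
  have "(\<Sum>p\<in>?g ` ((UNIV - {0}) \<times> ?T). fst p ^ a * snd p ^ b) =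
      (\<Sum>(x, s)\<in>(UNIV - {0}) \<times> ?T. x ^ (a + 5 * b) * s ^ b)"
    unfolding sum.reindex[OF klein_points_param_inj]
    by (auto intro!: sum.cong simp: power_mult_distrib power_add power_mult)
  also have "\<dots> = (\<Sum>x\<in>UNIV - {0::'a}. x ^ (a + 5 * b)) * (\<Sum>s\<in>?T. s ^ b)"
    by (simp only: sum_product sum.cartesian_product)
  also have "\<dots> = (if 7 dvd a + 5 * b \<and> (b = 0 \<or> b = 3) then 1 else 0)"
    unfolding power_sum_nonzero power_sum_roots[OF assms] by simp
  \<comment> \<open>The origin contributes 1 exactly when \<open>a = b = 0\<close>, cancelling the 1
    from the other points. This is the source of the condition \<open>a \<noteq> 0\<close>.\<close>
  finally have "(\<Sum>p\<in>klein_points. fst p ^ a * snd p ^ b) =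
      0 ^ a * 0 ^ b + (if 7 dvd a + 5 * b \<and> (b = 0 \<or> b = 3) then 1 else (0::'a))"
    unfolding klein_points_eq by (subst sum.insert) auto
  then show ?thesis using two dvd3 by (auto simp: power_0_left)
qed

end

section \<open>The monomials\<close>

text \<open>Pairs of the X-degree and the Y-degree, kept as plain data so that the exponent
  conditions can be checked by computation. Positions start at 0, so \<open>M i\<close> has entry
  \<open>i - 1\<close>.\<close>

definition M_exponents :: "(nat \<times> nat) list" where
  "M_exponents = [(0,0), (1,0), (0,1), (2,0), (1,1), (3,0), (0,2), (2,1), (4,0), (1,2), (3,1),
    (5,0), (2,2), (4,1), (6,0), (3,2), (5,1), (7,0), (4,2), (6,1), (5,2), (6,2)]"

text \<open>The first entry is a dummy: \<open>F\<^sub>1 = X\<^sup>7 + 1\<close> is not a monomial.\<close>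

definition Fperp_exponents :: "(nat \<times> nat) list" where
  "Fperp_exponents = [(0,0), (6,0), (6,2), (5,0), (5,2), (4,0), (6,1), (4,2), (3,0), (5,1), (3,2),
    (2,0), (4,1), (2,2), (1,0), (3,1), (1,2), (0,0), (2,1), (0,2), (1,1), (0,1)]"

lemma eval2_M:
  fixes p :: "'a::comm_ring_1 \<times> 'a"
  assumes "i \<in> {1..22}"
  shows "eval2 (M i) p = fst p ^ fst (M_exponents ! (i - 1)) * snd p ^ snd (M_exponents ! (i - 1))"
proof -
  have "(M i :: 'a poly poly) = map (\<lambda>(a, b). varX ^ a * varY ^ b) M_exponents ! (i - 1)"
    by (simp add: M_def M_exponents_def)
  also have "\<dots> = (\<lambda>(a, b). varX ^ a * varY ^ b) (M_exponents ! (i - 1))"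
    by (rule nth_map) (use assms in \<open>auto simp: M_exponents_def\<close>)
  finally show ?thesis by (simp add: case_prod_beta)
qed

lemma eval2_Fperp:
  fixes p :: "'a::comm_ring_1 \<times> 'a"
  assumes "j \<in> {2..22}"
  shows "eval2 (Fperp j) p =
    fst p ^ fst (Fperp_exponents ! (j - 1)) * snd p ^ snd (Fperp_exponents ! (j - 1))"
proof -
  have "(Fperp j :: 'a poly poly) = map (\<lambda>(a, b). varX ^ a * varY ^ b) Fperp_exponents ! (j - 1)"
    using assms by (simp add: Fperp_def Fperp_exponents_def nth_Cons')
  also have "\<dots> = (\<lambda>(a, b). varX ^ a * varY ^ b) (Fperp_exponents ! (j - 1))"
    by (rule nth_map) (use assms in \<open>auto simp: Fperp_exponents_def\<close>)
  finally show ?thesis by (simp add: case_prod_beta)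
qed

lemma eval2_Fperp_1: "eval2 (Fperp 1) p = fst p ^ 7 + 1"
  by (simp add: Fperp_def)

text \<open>The bracketed condition is the one from \<open>klein_power_sum\<close> for the exponents
  of the product. Here \<open>j\<close> starts at 1 to skip the dummy entry.\<close>

lemma M_exponents_pairing:
  "\<forall>i\<in>set [0..<22]. \<forall>j\<in>set [1..<22].
    (let a = fst (M_exponents ! i) + fst (Fperp_exponents ! j);
         b = snd (M_exponents ! i) + snd (Fperp_exponents ! j)
     in b \<le> 4 \<and> ((b = 0 \<and> 7 dvd a \<and> a \<noteq> 0 \<or> b = 3 \<and> 7 dvd a + 1) \<longleftrightarrow> i = j))"
  by code_simp

lemma M_exponents_bounds:
  "\<forall>i\<in>set [0..<22]. snd (M_exponents ! i) \<le> 2 \<and> (M_exponents ! i = (0, 0) \<longleftrightarrow> i = 0)"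
  by code_simp

section \<open>Biorthogonality on the quartic and the dual codes\<close>

lemma klein_biorthogonal:
  assumes card8: "CARD('a::{field, finite}) = 8" and i: "i \<in> {1..22}" and j: "j \<in> {1..22}"
  shows "(\<Sum>p\<in>(klein_points :: ('a \<times> 'a) set). eval2 (M i) p * eval2 (Fperp j) p) =
    (if i = j then 1 else 0)"
proof -
  obtain t :: 'a where root: "t ^ 3 = t + 1" using klein_root_exists[OF card8] ..
  note power_sum = klein_power_sum[OF card8 root]
  obtain a b where ab: "M_exponents ! (i - 1) = (a, b)" by fastforce
  show ?thesis
  proof (cases "j = 1")
    case True
    have "i - 1 \<in> set [0..<22]" using i by auto
    then have b: "b \<le> 2" "a = 0 \<and> b = 0 \<longleftrightarrow> i = 1"
      using M_exponents_bounds[rule_format, of "i - 1"] ab i by auto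
    \<comment> \<open>As \<open>b \<le> 2\<close>, a power sum here is nonzero only for
      \<open>b = 0\<close> and exponent of X divisible by 7. The two sums then cancel modulo 2
      unless \<open>a = 0\<close>, where only the first is 1. On the curve, \<open>X^7 + 1\<close>
      is the indicator of the origin.\<close>
    have "(\<Sum>p\<in>(klein_points :: ('a \<times> 'a) set). eval2 (M i) p * eval2 (Fperp j) p) =
        (\<Sum>p\<in>klein_points. fst p ^ (a + 7) * snd p ^ b) + (\<Sum>p\<in>klein_points. fst p ^ a * snd p ^ b)"
      unfolding True eval2_M[OF i] eval2_Fperp_1 ab
      by (simp add: algebra_simps power_add sum.distrib)
    also have "\<dots> = (if i = j then 1 else 0)"
      using b True two_eq_0_card8[OF card8] by (subst (1 2) power_sum) auto
    finally show ?thesis .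
  next
    case False
    then have j': "j \<in> {2..22}" using j by auto
    obtain c d where cd: "Fperp_exponents ! (j - 1) = (c, d)" by fastforce
    have "i - 1 \<in> set [0..<22]" "j - 1 \<in> set [1..<22]" "i - 1 = j - 1 \<longleftrightarrow> i = j"
      using i j' by auto
    then have pairing: "b + d \<le> 4"
      "(b + d = 0 \<and> 7 dvd a + c \<and> a + c \<noteq> 0 \<or> b + d = 3 \<and> 7 dvd a + c + 1) \<longleftrightarrow> i = j"
      using M_exponents_pairing[rule_format, of "i - 1" "j - 1"]
      unfolding ab cd Let_def fst_conv snd_conv by blast+
    have "(\<Sum>p\<in>(klein_points :: ('a \<times> 'a) set). eval2 (M i) p * eval2 (Fperp j) p) =
        (\<Sum>p\<in>klein_points. fst p ^ (a + c) * snd p ^ (b + d))"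
      unfolding eval2_M[OF i] eval2_Fperp[OF j'] ab cd by (simp add: mult_ac power_add)
    also have "\<dots> = (if i = j then 1 else 0)"
      unfolding power_sum[OF pairing(1)] pairing(2) ..
    finally show ?thesis .
  qed
qed

theorem mainTheorem8:
  assumes "CARD('a::{field, finite}) = 8"
  shows "card (klein_points :: ('a \<times> 'a) set) = 22 \<and>
    (\<forall>P :: 22 \<Rightarrow> 'a \<times> 'a. bij_betw P UNIV klein_points \<longrightarrow>
      (\<forall>i\<in>{1..22}. \<forall>j\<in>{1..22}.
        (\<Sum>s\<in>UNIV. eval2 (M i) (P s) * eval2 (Fperp j) (P s)) = (if i = j then 1 else 0)) \<and>
      (\<forall>A \<subseteq> {1..22}.
        dual_code (vec.span ((\<lambda>i. ev P (M i)) ` A))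
          = vec.span ((\<lambda>j. ev P (Fperp j)) ` ({1..22} - A))))"
proof (intro conjI allI impI)
  show "card (klein_points :: ('a \<times> 'a) set) = 22"
    using klein_root_exists[OF assms] card_klein_points[OF assms] by blast
next
  fix P :: "22 \<Rightarrow> 'a \<times> 'a"
  assume P: "bij_betw P UNIV klein_points"
  have bi: "(\<Sum>s\<in>UNIV. eval2 (M i) (P s) * eval2 (Fperp j) (P s)) = (if i = j then 1 else 0)"
    if "i \<in> {1..22}" "j \<in> {1..22}" for i j
    unfolding klein_biorthogonal[OF assms that, symmetric] by (rule sum.reindex_bij_betw[OF P])
  then show "\<forall>i\<in>{1..22}. \<forall>j\<in>{1..22}.
      (\<Sum>s\<in>UNIV. eval2 (M i) (P s) * eval2 (Fperp j) (P s)) = (if i = j then 1 else 0)"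
    by blast
  fix A :: "nat set"
  assume "A \<subseteq> {1..22}"
  then show "dual_code (vec.span ((\<lambda>i. ev P (M i)) ` A))
      = vec.span ((\<lambda>j. ev P (Fperp j)) ` ({1..22} - A))"
    \<comment> \<open>The scalar product of two evaluation vectors is the sum in \<open>bi\<close>,
      and the 22 indices match the length of the code.\<close>
    by (intro dual_code_biorthogonal) (simp_all add: scalar_product_def ev_def bi)
qed

end
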